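(* Let $O^*\subseteq N_x$ be an optimal set of data stores for the Data Store Selection problem, i.e. a minimizer of $\phi$ over subsets of $N_x$, and let $D$ be the solution found by algorithm $\mathrm{DS}_{\mathrm{Pot}}$ (described in the context). Then $$\phi(D)\le \frac{H_{|D|}}{L_{|D|}}\,\phi(O^* ).$$
   Context: $N_x$ is a finite set of $n_x$ data stores (those giving a positive indication for a requested item $x$); each $j\in N_x$ has an access cost $c_j\ge 1$ and a misindication ratio $\rho_j\in[0,1]$ (the probability that $x$ is not in data store $j$ despite its positive indication); $\beta\ge 1$ is the miss penalty. Misindications are assumed mutually independent, so that for $D\subseteq N_x$ the expected cost is $\phi(D)=\sum_{j\in D}c_j+\beta\prod_{j\in D}\rho_j$ (empty sum $0$, empty product $1$). The Data Store Selection (DSS) problem is to find $D\subseteq N_x$ minimizing $\phi(D)$. For each $k$, $L_k$ and $H_k$ denote the sum of the $k$ smallest and of the $k$ largest access costs of data stores in $N_x$, respectively. Algorithm $\mathrm{DS}_{\mathrm{Pot}}$: order $N_x$ as $\ell_1,\dots,\ell_{n_x}$ in non-decreasing order of misindication ratio, i.e. $\rho_{\ell_1}\le\rho_{\ell_2}\le\dots\le\rho_{\ell_{n_x}}$; for $k=1,\dots,n_x$ let $D_k=\{\ell_1,\dots,\ell_k\}$ and let $P(k)=L_k+\beta\prod_{j=1}^k\rho_{\ell_j}$ (the potential function); return $D=D_k$ for a $k$ minimizing $P(k)$.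
   Formalization: Assumes additionally that some optimal set is nonempty; otherwise the claim can fail: for one data store with cost 2, misindication ratio 1 and miss penalty 1, the optimum is the empty set with cost 1, while the algorithm returns the store with cost 3 and the ratio H/L is 1. *)

theory Defs
  imports Complex_Main "HOL-Library.Multiset"
begin

(* Expected cost of accessing D, misindications being mutually independent:
   the penalty beta is paid exactly when every store of D misindicates. *)
definition dss_cost :: "('a \<Rightarrow> real) \<Rightarrow> ('a \<Rightarrow> real) \<Rightarrow> real \<Rightarrow> 'a set \<Rightarrow> real" where
  "dss_cost c \<rho> \<beta> D = (\<Sum>j\<in>D. c j) + \<beta> * (\<Prod>j\<in>D. \<rho> j)"

definition dss_optimal :: "('a \<Rightarrow> real) \<Rightarrow> ('a \<Rightarrow> real) \<Rightarrow> real \<Rightarrow> 'a set \<Rightarrow> 'a set \<Rightarrow> bool" where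
  "dss_optimal c \<rho> \<beta> N D \<longleftrightarrow> D \<subseteq> N \<and> (\<forall>D'. D' \<subseteq> N \<longrightarrow> dss_cost c \<rho> \<beta> D \<le> dss_cost c \<rho> \<beta> D')"

(* Costs are collected in a multiset, so that equal costs of different stores
   are counted separately. *)
definition sorted_costs :: "('a \<Rightarrow> real) \<Rightarrow> 'a set \<Rightarrow> real list" where
  "sorted_costs c N = sorted_list_of_multiset (image_mset c (mset_set N))"

definition lowest_sum :: "('a \<Rightarrow> real) \<Rightarrow> 'a set \<Rightarrow> nat \<Rightarrow> real" where
  "lowest_sum c N k = sum_list (take k (sorted_costs c N))"

definition highest_sum :: "('a \<Rightarrow> real) \<Rightarrow> 'a set \<Rightarrow> nat \<Rightarrow> real" where
  "highest_sum c N k = sum_list (take k (rev (sorted_costs c N)))"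

definition potential ::
  "('a \<Rightarrow> real) \<Rightarrow> ('a \<Rightarrow> real) \<Rightarrow> real \<Rightarrow> 'a set \<Rightarrow> 'a list \<Rightarrow> nat \<Rightarrow> real" where
  "potential c \<rho> \<beta> N ls k = lowest_sum c N k + \<beta> * (\<Prod>i<k. \<rho> (ls ! i))"

(* A relation rather than a function: ties in the ordering by misindication
   ratio and ties among the minimizers of the potential are broken arbitrarily.
   The empty selection (k = 0) is not a candidate. *)
definition ds_pot_output ::
  "('a \<Rightarrow> real) \<Rightarrow> ('a \<Rightarrow> real) \<Rightarrow> real \<Rightarrow> 'a set \<Rightarrow> 'a set \<Rightarrow> bool" where
  "ds_pot_output c \<rho> \<beta> N D \<longleftrightarrow>
     (\<exists>ls k. distinct ls \<and> set ls = N \<and> sorted (map \<rho> ls) \<and>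
        k \<in> {1..card N} \<and>
        (\<forall>k'\<in>{1..card N}. potential c \<rho> \<beta> N ls k \<le> potential c \<rho> \<beta> N ls k') \<and>
        D = set (take k ls))"

(* If the empty set is the only optimal selection, the approximation bound for
   the (always nonempty) output can fail, already for a single store. *)
lemma ds_pot_bound_fails_if_only_empty_optimal:
  fixes c \<rho> :: "nat \<Rightarrow> real"
  defines "c \<equiv> \<lambda>_. 2" and "\<rho> \<equiv> \<lambda>_. 1"
  shows "dss_optimal c \<rho> 1 {0} {}"
    and "ds_pot_output c \<rho> 1 {0} {0}"
    and "\<not> dss_cost c \<rho> 1 {0}
           \<le> highest_sum c {0} (card {0::nat}) / lowest_sum c {0} (card {0::nat}) * dss_cost c \<rho> 1 {}"
proof -
  show "dss_optimal c \<rho> 1 {0} {}"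
    by (auto simp: dss_optimal_def dss_cost_def c_def \<rho>_def)
  have "distinct [0::nat] \<and> set [0::nat] = {0} \<and> sorted (map \<rho> [0]) \<and>
        (1::nat) \<in> {1..card {0::nat}} \<and>
        (\<forall>k'\<in>{1..card {0::nat}}. potential c \<rho> 1 {0} [0] 1 \<le> potential c \<rho> 1 {0} [0] k') \<and>
        {0::nat} = set (take 1 [0])"
    by simp
  then show "ds_pot_output c \<rho> 1 {0} {0}"
    unfolding ds_pot_output_def by blast
  have "sorted_costs c {0} = [2]"
    by (simp add: sorted_costs_def c_def)
  then show "\<not> dss_cost c \<rho> 1 {0}
           \<le> highest_sum c {0} (card {0::nat}) / lowest_sum c {0} (card {0::nat}) * dss_cost c \<rho> 1 {}"
    by (simp add: dss_cost_def highest_sum_def lowest_sum_def c_def \<rho>_def)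
qed

end

(* For the size k of the output D, the cost c(D) lies between L k and H k, so replacing c(D)
   by L k loses at most the factor H k / L k: the cost of D is at most (H k / L k) * P(k).
   On the other hand P(card S) bounds the cost of every nonempty S from below, since both
   the cost sum and the miss probability are replaced by their minimum over selections of
   that size; and P(k) is minimal. *)
theory Submission imports Defs begin

text \<open>Drives the inductions that compare a selection with a prefix of a sorted list: one
  element \<open>y\<close> of \<open>B\<close> is charged to the head \<open>x\<close>, and the rest
  still fits into the tail. If \<open>x\<close> occurs in \<open>B\<close>, take
  \<open>y = x\<close>; otherwise \<open>B\<close> already lies in \<open>xs\<close> and any element
  serves.\<close>

lemma subset_mset_ConsE:
  fixes x :: "'b::linorder"
  assumes "B \<subseteq># mset (x # xs)" "sorted (x # xs)" "B \<noteq> {#}"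
  obtains y B' where "B = add_mset y B'" "x \<le> y" "B' \<subseteq># mset xs"
proof (cases "x \<in># B")
  case True
  then obtain B' where "B = add_mset x B'"
    by (metis insert_DiffM)
  with assms(1) show ?thesis
    by (intro that[of x B']) auto
next
  case False
  with assms(1) have sub: "B \<subseteq># mset xs"
    by (simp add: subset_mset.add_increasing2 subseteq_mset_def not_in_iff split: if_splits)
      (metis (full_types) count_greater_zero_iff le0 not_in_iff)
  from assms(3) obtain y B' where B: "B = add_mset y B'"
    by (metis multiset_cases)
  with sub have "y \<in> set xs"
    by (metis mset_subset_eqD set_mset_mset union_single_eq_member)
  moreover have "B' \<subseteq># mset xs"
    using sub B by (metis mset_subset_eq_insertD subset_mset.less_imp_le)
  ultimately show ?thesis
    using assms(2) B by (intro that[of y B']) auto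
qed

text \<open>Induction on \<open>xs\<close>, charging one element of \<open>B\<close> to each head.
  Working with multisets keeps equal costs of different stores apart.\<close>

lemma sum_list_take_le_sum_mset:
  fixes xs :: "'b::{linorder,ordered_comm_monoid_add} list"
  assumes "sorted xs" "B \<subseteq># mset xs"
  shows "sum_list (take (size B) xs) \<le> sum_mset B"
  using assms
proof (induction xs arbitrary: B)
  case (Cons x xs)
  show ?case
  proof (cases "B = {#}")
    case False
    then obtain y B' where B: "B = add_mset y B'" "x \<le> y" "B' \<subseteq># mset xs"
      using Cons.prems subset_mset_ConsE by metis
    with Cons show ?thesis
      by (auto intro: add_mono)
  qed simp
qed simp

text \<open>Negation reverses the order: the negated reversed list is sorted, so the bound for
  smallest sums applies to it.\<close>

lemma sum_mset_le_sum_list_take_rev: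
  fixes xs :: "'b::linordered_ab_group_add list"
  assumes "sorted xs" "B \<subseteq># mset xs"
  shows "sum_mset B \<le> sum_list (take (size B) (rev xs))"
proof -
  have "sorted (map uminus (rev xs))"
    using assms(1) by (simp add: sorted_wrt_map sorted_wrt_rev)
  moreover have "image_mset uminus B \<subseteq># mset (map uminus (rev xs))"
    using assms(2) by (simp add: image_mset_subseteq_mono)
  ultimately have "sum_list (map uminus (take (size B) (rev xs))) \<le> sum_mset (image_mset uminus B)"
    using sum_list_take_le_sum_mset[of "map uminus (rev xs)" "image_mset uminus B"]
    by (simp add: take_map)
  moreover have "sum_list (map uminus ys) = - sum_list ys" for ys :: "'b list"
    by (induction ys) auto
  moreover have "sum_mset (image_mset uminus M) = - sum_mset M" for M :: "'b multiset"
    by (induction M) auto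
  ultimately show ?thesis
    by simp
qed

lemma prod_list_take_le_prod_mset:
  fixes xs :: "'b::linordered_semidom list"
  assumes "sorted xs" "B \<subseteq># mset xs" "\<And>x. x \<in> set xs \<Longrightarrow> 0 \<le> x"
  shows "prod_list (take (size B) xs) \<le> prod_mset B"
  using assms
proof (induction xs arbitrary: B)
  case (Cons x xs)
  show ?case
  proof (cases "B = {#}")
    case False
    then obtain y B' where B: "B = add_mset y B'" "x \<le> y" "B' \<subseteq># mset xs"
      using Cons.prems subset_mset_ConsE by metis
    \<comment> \<open>Multiplying \<open>x \<le> y\<close> by the induction hypothesis is monotone
      only with a nonnegative prefix product and a nonnegative \<open>y\<close>; the latter follows
      from \<open>0 \<le> x \<le> y\<close>.\<close>
    have "0 \<le> prod_list (take n xs)" for n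
      using Cons.prems(3) by (intro prod_list_nonneg) (auto dest: in_set_takeD)
    moreover have "0 \<le> y"
      using Cons.prems(3)[of x] B(2) by simp
    ultimately show ?thesis
      using Cons B by (auto intro: mult_mono)
  qed simp
qed simp

lemma image_mset_set_subset_sorted_costs:
  assumes "finite N" "A \<subseteq> N"
  shows "image_mset c (mset_set A) \<subseteq># mset (sorted_costs c N)"
  using assms by (simp add: sorted_costs_def image_mset_subseteq_mono subset_imp_msubset_mset_set)

lemma lowest_sum_le:
  assumes "finite N" "A \<subseteq> N"
  shows "lowest_sum c N (card A) \<le> sum c A"
  using sum_list_take_le_sum_mset[OF _ image_mset_set_subset_sorted_costs[OF assms, of c]]
  by (simp add: lowest_sum_def sorted_costs_def sum_unfold_sum_mset)

lemma sum_le_highest_sum: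
  assumes "finite N" "A \<subseteq> N"
  shows "sum c A \<le> highest_sum c N (card A)"
  using sum_mset_le_sum_list_take_rev[OF _ image_mset_set_subset_sorted_costs[OF assms, of c]]
  by (simp add: highest_sum_def sorted_costs_def sum_unfold_sum_mset)

text \<open>Makes the approximation ratio a genuine quotient. The prefix has a positive head and
  nonnegative further entries.\<close>

lemma lowest_sum_pos:
  assumes "finite N" "N \<noteq> {}" "\<And>j. j \<in> N \<Longrightarrow> 0 < c j" "0 < k"
  shows "0 < lowest_sum c N k"
proof -
  have set: "set (sorted_costs c N) = c ` N"
    using assms(1) by (simp add: sorted_costs_def)
  with assms(2) obtain x xs where Cons: "sorted_costs c N = x # xs"
    by (cases "sorted_costs c N") auto
  obtain m where "k = Suc m"
    using assms(4) by (cases k) auto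
  moreover have "\<forall>y \<in> set (x # xs). 0 < y"
    using set Cons assms(3) by auto
  ultimately show ?thesis
    by (auto simp: lowest_sum_def Cons intro!: add_pos_nonneg sum_list_nonneg
        intro: less_imp_le dest!: in_set_takeD)
qed

lemma prod_take_le_prod:
  fixes \<rho> :: "'a \<Rightarrow> real"
  assumes "distinct ls" "sorted (map \<rho> ls)" "\<And>j. j \<in> set ls \<Longrightarrow> 0 \<le> \<rho> j" "A \<subseteq> set ls"
  shows "(\<Prod>i<card A. \<rho> (ls ! i)) \<le> prod \<rho> A"
proof -
  \<comment> \<open>Keeps every index \<open>i < card A\<close> within \<open>ls\<close>, so that
    the indexed product is the product over a full prefix of length \<open>card A\<close>.\<close>
  have "card A \<le> length ls"
    by (metis assms(1,4) card_mono distinct_card finite_set)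
  then have "(\<Prod>i<card A. \<rho> (ls ! i)) = prod_list (take (card A) (map \<rho> ls))"
    by (simp add: prod.list_conv_set_nth atLeast0LessThan)
  moreover have "image_mset \<rho> (mset_set A) \<subseteq># mset (map \<rho> ls)"
    using assms(1,4)
    by (simp add: image_mset_subseteq_mono subset_imp_msubset_mset_set flip: mset_set_set)
  ultimately show ?thesis
    using prod_list_take_le_prod_mset[OF assms(2), of "image_mset \<rho> (mset_set A)"] assms(3)
    by (auto simp: prod_unfold_prod_mset)
qed

lemma potential_le_dss_cost:
  assumes "distinct ls" "sorted (map \<rho> ls)" "\<And>j. j \<in> set ls \<Longrightarrow> 0 \<le> \<rho> j"
    and "0 \<le> \<beta>" "A \<subseteq> set ls"
  shows "potential c \<rho> \<beta> (set ls) ls (card A) \<le> dss_cost c \<rho> \<beta> A"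
  unfolding potential_def dss_cost_def
  using assms by (intro add_mono mult_left_mono lowest_sum_le prod_take_le_prod) auto

theorem theorem14:
  fixes N :: "'a set" and c \<rho> :: "'a \<Rightarrow> real" and \<beta> :: real and Ostar D :: "'a set"
  assumes "finite N"
    and "\<And>j. j \<in> N \<Longrightarrow> 1 \<le> c j"
    and "\<And>j. j \<in> N \<Longrightarrow> 0 \<le> \<rho> j \<and> \<rho> j \<le> 1"
    and "1 \<le> \<beta>"
    and "\<exists>S. S \<noteq> {} \<and> dss_optimal c \<rho> \<beta> N S"
    and "dss_optimal c \<rho> \<beta> N Ostar"
    and "ds_pot_output c \<rho> \<beta> N D"
  shows "dss_cost c \<rho> \<beta> D
           \<le> highest_sum c N (card D) / lowest_sum c N (card D) * dss_cost c \<rho> \<beta> Ostar"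
proof -
  obtain ls k where ls: "distinct ls" "set ls = N" "sorted (map \<rho> ls)"
    and k: "k \<in> {1..card N}"
    and min: "\<And>k'. k' \<in> {1..card N} \<Longrightarrow> potential c \<rho> \<beta> N ls k \<le> potential c \<rho> \<beta> N ls k'"
    and D: "D = set (take k ls)"
    using assms(7) unfolding ds_pot_output_def by blast
  \<comment> \<open>\<open>Ostar\<close> may be empty, and size 0 is not among the sizes over which
    \<open>k\<close> is minimal. A nonempty optimum \<open>S\<close> has the same cost and an
    admissible size.\<close>
  obtain S where S: "S \<noteq> {}" "dss_optimal c \<rho> \<beta> N S"
    using assms(5) by blast
  have "S \<subseteq> N" and eq: "dss_cost c \<rho> \<beta> S = dss_cost c \<rho> \<beta> Ostar"
    using S(2) assms(6) by (auto simp: dss_optimal_def intro: antisym)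
  then have "card S \<in> {1..card N}"
    using S(1) assms(1) by (auto simp: card_mono Suc_le_eq card_gt_0_iff finite_subset)
  then have "potential c \<rho> \<beta> N ls k \<le> potential c \<rho> \<beta> N ls (card S)"
    by (rule min)
  also have "\<dots> \<le> dss_cost c \<rho> \<beta> Ostar"
    using potential_le_dss_cost[of ls \<rho> \<beta> S c] ls assms(3,4) \<open>S \<subseteq> N\<close> eq by simp
  finally have pot: "potential c \<rho> \<beta> N ls k \<le> dss_cost c \<rho> \<beta> Ostar" .

  have "k \<le> length ls"
    using k ls by (auto simp: distinct_card)
  then have card: "card D = k"
    using ls(1) by (simp add: D distinct_card)
  have "D \<subseteq> N"
    using ls(2) by (auto simp: D dest: in_set_takeD)
  let ?L = "lowest_sum c N k" and ?H = "highest_sum c N k"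
  let ?M = "\<beta> * prod \<rho> D"
  have L: "?L \<le> sum c D" and H: "sum c D \<le> ?H"
    using lowest_sum_le[OF assms(1) \<open>D \<subseteq> N\<close>] sum_le_highest_sum[OF assms(1) \<open>D \<subseteq> N\<close>]
    by (simp_all add: card)
  have "0 < ?L"
    \<comment> \<open>The range of \<open>k\<close> yields both \<open>0 < k\<close> and
      \<open>N \<noteq> {}\<close>.\<close>
    using assms(1) k by (intro lowest_sum_pos) (force dest: assms(2))+
  then have ratio: "1 \<le> ?H / ?L"
    using L H by simp
  have "0 \<le> prod \<rho> D"
    using \<open>D \<subseteq> N\<close> assms(3) by (intro prod_nonneg) auto
  then have M: "0 \<le> ?M"
    using assms(4) by simp
  \<comment> \<open>The potential at \<open>k\<close> contains the exact miss term of
    \<open>D\<close>; only the access cost is replaced, by \<open>?L\<close>.\<close>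
  have "prod \<rho> D = (\<Prod>i<k. \<rho> (ls ! i))"
    using ls(1) \<open>k \<le> length ls\<close> unfolding D
    by (simp add: prod.distinct_set_conv_list prod.list_conv_set_nth atLeast0LessThan)
  then have "potential c \<rho> \<beta> N ls k = ?L + ?M"
    by (simp add: potential_def)
  then have "?H / ?L * (?L + ?M) \<le> ?H / ?L * dss_cost c \<rho> \<beta> Ostar"
    using pot ratio by (intro mult_left_mono) auto
  moreover have "dss_cost c \<rho> \<beta> D \<le> ?H / ?L * (?L + ?M)"
    \<comment> \<open>Distributing the ratio turns \<open>?L\<close> into \<open>?H\<close>, which
      bounds the access cost, and multiplies the nonnegative \<open>?M\<close> by a factor of at
      least 1.\<close>
    using H mult_right_mono[OF ratio M] \<open>0 < ?L\<close> by (simp add: dss_cost_def distrib_left)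
  ultimately show ?thesis
    by (simp add: card)
qed

end
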